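(* Let $d \ge 1$. If $f \in H^2_d$ is cyclic, then $Z(f^* )$ has outer $H^2_d$-capacity zero, i.e. $\operatorname{cap}^*_{H^2_d}(Z(f^* )) = 0$.
   Context: $\mathbb{B}_d$ is the open Euclidean unit ball of $\mathbb{C}^d$, with boundary sphere $\partial\mathbb{B}_d$. The Drury--Arveson space $H^2_d$ is the reproducing kernel Hilbert space of holomorphic functions on $\mathbb{B}_d$ with kernel $K(z,w) = \frac{1}{1 - \langle z,w\rangle}$. A function $f \in H^2_d$ is cyclic if there is a sequence $(p_n)$ of polynomials such that $p_n f \to 1$ in $H^2_d$. For $f \in H^2_d$ put $f^*(\zeta) = \lim_{r \nearrow 1} f(r\zeta)$, which exists for all $\zeta \in \partial\mathbb{B}_d$ outside a set of outer $H^2_d$-capacity zero, and $Z(f^* ) = \{\zeta \in \partial\mathbb{B}_d : f^*(\zeta) = 0\}$ (the points where the limit exists and equals $0$). The $H^2_d$-energy of a Borel probability measure $\mu$ on $\partial\mathbb{B}_d$ is $$\mathcal{E}(\mu) = \sup_{0 \le r < 1} \int_{\partial\mathbb{B}_d}\int_{\partial\mathbb{B}_d} \operatorname{Re} K(rz,rw)\, d\mu(w)\, d\mu(z) \in [0,\infty].$$ For compact $F \subset \partial\mathbb{B}_d$, $\operatorname{cap}_{H^2_d}(F) = \sup\{1/\mathcal{E}(\mu) : \mu$ a Borel probability measure supported on $F\}$ (with $1/\infty = 0$ and $\operatorname{cap}(\emptyset) = 0$). For arbitrary $E \subset \partial\mathbb{B}_d$, the inner capacity is $\operatorname{cap}_{H^2_d}(E)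 = \sup\{\operatorname{cap}_{H^2_d}(F) : F \subset E \text{ compact}\}$ and the outer capacity is $\operatorname{cap}^*_{H^2_d}(E) = \inf\{\operatorname{cap}_{H^2_d}(G) : G \supset E,\ G \text{ open in } \partial\mathbb{B}_d\}$. *)

theory Defs
  imports "HOL-Probability.Probability"
begin

section \<open>Reproducing kernel Hilbert spaces\<close>

definition ip_norm :: "(('a \<Rightarrow> complex) \<Rightarrow> ('a \<Rightarrow> complex) \<Rightarrow> complex) \<Rightarrow> ('a \<Rightarrow> complex) \<Rightarrow> real" where
  "ip_norm ip f = sqrt (Re (ip f f))"

definition ip_dist ::
    "(('a \<Rightarrow> complex) \<Rightarrow> ('a \<Rightarrow> complex) \<Rightarrow> complex) \<Rightarrow> ('a \<Rightarrow> complex) \<Rightarrow> ('a \<Rightarrow> complex) \<Rightarrow> real" where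
  "ip_dist ip f g = ip_norm ip (\<lambda>x. f x - g x)"

text \<open>
  A complex function on a set \<open>X\<close> is represented by its extension by \<open>0\<close> to the whole type,
  so that equality of functions on \<open>X\<close> is equality in HOL.  The inner product \<open>ip\<close>
  (linear in the first argument) is only meaningful on \<open>H\<close>.  Given \<open>X\<close> and \<open>K\<close>, the last two
  assumptions determine \<open>H\<close>, and \<open>ip\<close> on \<open>H\<close>, uniquely.
\<close>

locale rkhs =
  fixes X :: "'a set"
    and K :: "'a \<Rightarrow> 'a \<Rightarrow> complex"
    and H :: "('a \<Rightarrow> complex) set"
    and ip :: "('a \<Rightarrow> complex) \<Rightarrow> ('a \<Rightarrow> complex) \<Rightarrow> complex"
  assumes outside: "f \<in> H \<Longrightarrow> x \<notin> X \<Longrightarrow> f x = 0"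
    and zero_mem: "(\<lambda>x. 0) \<in> H"
    and add_mem: "f \<in> H \<Longrightarrow> g \<in> H \<Longrightarrow> (\<lambda>x. f x + g x) \<in> H"
    and scale_mem: "f \<in> H \<Longrightarrow> (\<lambda>x. c * f x) \<in> H"
    and ip_add_left: "f \<in> H \<Longrightarrow> g \<in> H \<Longrightarrow> h \<in> H \<Longrightarrow> ip (\<lambda>x. f x + g x) h = ip f h + ip g h"
    and ip_scale_left: "f \<in> H \<Longrightarrow> g \<in> H \<Longrightarrow> ip (\<lambda>x. c * f x) g = c * ip f g"
    and ip_cnj: "f \<in> H \<Longrightarrow> g \<in> H \<Longrightarrow> ip g f = cnj (ip f g)"
    and ip_pos: "f \<in> H \<Longrightarrow> f \<noteq> (\<lambda>x. 0) \<Longrightarrow> 0 < Re (ip f f)"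
    and complete: "\<lbrakk>\<And>k. s k \<in> H; \<And>e. 0 < e \<Longrightarrow> \<exists>N. \<forall>m\<ge>N. \<forall>n\<ge>N. ip_dist ip (s m) (s n) < e\<rbrakk>
          \<Longrightarrow> \<exists>g\<in>H. (\<lambda>k. ip_dist ip (s k) g) \<longlonglongrightarrow> 0"
    and kernel_mem: "w \<in> X \<Longrightarrow> (\<lambda>z. if z \<in> X then K z w else 0) \<in> H"
    and reproducing: "f \<in> H \<Longrightarrow> w \<in> X \<Longrightarrow> f w = ip f (\<lambda>z. if z \<in> X then K z w else 0)"


section \<open>The Drury--Arveson space\<close>

definition hermitian_inner :: "complex ^ 'n \<Rightarrow> complex ^ 'n \<Rightarrow> complex" where
  "hermitian_inner z w = (\<Sum>i\<in>UNIV. z $ i * cnj (w $ i))"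

definition da_kernel :: "complex ^ 'n \<Rightarrow> complex ^ 'n \<Rightarrow> complex" where
  "da_kernel z w = 1 / (1 - hermitian_inner z w)"

text \<open>Holomorphy in several variables: a complex-linear Frechet derivative at every point.\<close>

definition holomorphic_vec_on :: "(complex ^ 'n \<Rightarrow> complex) \<Rightarrow> (complex ^ 'n) set \<Rightarrow> bool" where
  "holomorphic_vec_on f S \<longleftrightarrow>
     (\<forall>z\<in>S. \<exists>D. (f has_derivative D) (at z) \<and> (\<forall>c v. D (c *s v) = c * D v))"

text \<open>
  \<open>(H, ip)\<close> is the space \<open>H\<^sup>2\<^sub>d\<close> with its inner product, where \<open>d = CARD('n)\<close>.  (Holomorphy
  already follows from the choice of kernel.)
\<close>

definition drury_arveson ::
    "(complex ^ 'n \<Rightarrow> complex) set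
     \<Rightarrow> ((complex ^ 'n \<Rightarrow> complex) \<Rightarrow> (complex ^ 'n \<Rightarrow> complex) \<Rightarrow> complex) \<Rightarrow> bool" where
  "drury_arveson H ip \<longleftrightarrow>
     rkhs (ball 0 1) da_kernel H ip \<and> (\<forall>f\<in>H. holomorphic_vec_on f (ball 0 1))"

definition polynomial_vec :: "(complex ^ 'n \<Rightarrow> complex) \<Rightarrow> bool" where
  "polynomial_vec p \<longleftrightarrow>
     (\<exists>(A :: ('n \<Rightarrow> nat) set) c. finite A \<and>
        p = (\<lambda>z. \<Sum>\<alpha>\<in>A. c \<alpha> * (\<Prod>i\<in>UNIV. (z $ i) ^ \<alpha> i)))"

text \<open>The constant function \<open>1\<close> on the ball is \<open>indicator (ball 0 1)\<close>.\<close>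

definition da_cyclic ::
    "(complex ^ 'n \<Rightarrow> complex) set
     \<Rightarrow> ((complex ^ 'n \<Rightarrow> complex) \<Rightarrow> (complex ^ 'n \<Rightarrow> complex) \<Rightarrow> complex)
     \<Rightarrow> (complex ^ 'n \<Rightarrow> complex) \<Rightarrow> bool" where
  "da_cyclic H ip f \<longleftrightarrow>
     (\<exists>p. (\<forall>k. polynomial_vec (p k) \<and> (\<lambda>z. p k z * f z) \<in> H) \<and>
        (\<lambda>k::nat. ip_dist ip (\<lambda>z. p k z * f z) (indicator (ball 0 1))) \<longlonglongrightarrow> 0)"

text \<open>The points of the sphere at which the radial limit exists and equals \<open>0\<close>.\<close>

definition radial_zero_set :: "(complex ^ 'n \<Rightarrow> complex) \<Rightarrow> (complex ^ 'n) set" where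
  "radial_zero_set f = {\<zeta> \<in> sphere 0 1. ((\<lambda>r. f (r *\<^sub>R \<zeta>)) \<longlongrightarrow> 0) (at_left 1)}"


section \<open>Energy and capacity\<close>

text \<open>Borel probability measures on the unit sphere supported on \<open>F\<close>.\<close>

definition sphere_probs :: "(complex ^ 'n) set \<Rightarrow> (complex ^ 'n) measure set" where
  "sphere_probs F =
     {\<mu>. prob_space \<mu> \<and> sets \<mu> = sets (restrict_space borel (sphere 0 1)) \<and>
         emeasure \<mu> (sphere 0 1 - F) = 0}"

text \<open>
  For \<open>0 \<le> r < 1\<close> and \<open>z\<close>, \<open>w\<close> on the sphere, \<open>Re (da_kernel (r z) (r w)) > 1/2\<close>; hence the
  coercion to \<^typ>\<open>ennreal\<close> truncates nothing.  In \<^typ>\<open>ennreal\<close>, \<open>1 / \<infinity> = 0\<close> and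
  the supremum of the empty set is \<open>0\<close>.
\<close>

definition da_energy :: "(complex ^ 'n) measure \<Rightarrow> ennreal" where
  "da_energy \<mu> =
     (SUP r\<in>{0..<1::real}. \<integral>\<^sup>+ z. (\<integral>\<^sup>+ w. ennreal (Re (da_kernel (r *\<^sub>R z) (r *\<^sub>R w))) \<partial>\<mu>) \<partial>\<mu>)"

definition da_cap_compact :: "(complex ^ 'n) set \<Rightarrow> ennreal" where
  "da_cap_compact F = (SUP \<mu>\<in>sphere_probs F. 1 / da_energy \<mu>)"

definition da_inner_cap :: "(complex ^ 'n) set \<Rightarrow> ennreal" where
  "da_inner_cap E = (SUP F\<in>{F. compact F \<and> F \<subseteq> E}. da_cap_compact F)"

definition da_outer_cap :: "(complex ^ 'n) set \<Rightarrow> ennreal" where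
  "da_outer_cap E =
     (INF G\<in>{G. openin (top_of_set (sphere 0 1)) G \<and> E \<subseteq> G}. da_inner_cap G)"

end

theory Submission imports Defs begin

text \<open>
  If \<open>f\<close> is cyclic, then \<open>g = p f - 1\<close> can be made small in norm by the choice of a polynomial \<open>p\<close>,
  while \<open>g\<close> has radial limit \<open>-1\<close> on the radial zero set of \<open>f\<close>.  Averaging the reproducing property
  over a measure \<open>\<mu>\<close> of finite energy gives
  \<open>\<bar>\<integral>\<^bsub>B\<^esub> Re g(r \<zeta>) d\<mu>(\<zeta>)\<bar> \<le> \<parallel>g\<parallel> \<E>(\<mu>)\<^sup>1\<^sup>/\<^sup>2\<close>,
  and density of the kernel functions makes the same integral of \<open>g(r \<zeta>) - g(s \<zeta>)\<close> uniformly small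
  for \<open>r\<close>, \<open>s\<close> close to \<open>1\<close>.  No maximal inequality is needed, because the radial limit can be tracked
  along radii \<open>r\<^sub>j\<close> tending to \<open>1\<close> so fast that each increment is as small as desired: at a point of the
  zero set, either \<open>Re g(r\<^sub>0 \<zeta>) < -1/2\<close>, or some increment \<open>Re g(r\<^sub>j \<zeta>) - Re g(r\<^sub>j\<^sub>+\<^sub>1 \<zeta>)\<close> exceeds
  \<open>2\<^sup>-\<^sup>j / 8\<close>.  These conditions define an open set, and the two bounds force its capacity to be at most a
  multiple of the square of the bound on \<open>\<parallel>g\<parallel>\<close>.
\<close>

section \<open>Reproducing kernel Hilbert spaces\<close>

text \<open>A quadratic in \<open>t\<close> that is nowhere negative has nonpositive discriminant.
  This serves both the Cauchy-Schwarz inequality and the near-orthogonality of a minimizing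
  sequence.\<close>

lemma quadratic_nonneg_imp:
  fixes a b c :: real
  assumes "\<And>t. 0 \<le> a + 2 * t * b + t\<^sup>2 * c" "0 \<le> c"
  shows "b\<^sup>2 \<le> a * c"
proof (cases "c = 0")
  case True
  have "b = 0"
  proof (rule ccontr)
    assume "b \<noteq> 0"
    \<comment> \<open>For \<open>c = 0\<close> the expression is affine in \<open>t\<close>, and at
      this point it equals -1.\<close>
    with assms(1)[of "- (a + 1) / (2 * b)"] True show False by (simp add: field_simps)
  qed
  then show ?thesis using True by simp
next
  case False
  with assms(2) have c: "c > 0" by simp
  have "0 \<le> (a + 2 * (- b / c) * b + (- b / c)\<^sup>2 * c) * c"
    using assms(1)[of "- b / c"] c by (intro mult_nonneg_nonneg) auto
  also have "\<dots> = a * c - b\<^sup>2" using c by (simp add: field_simps power2_eq_square)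
  finally show ?thesis by simp
qed

context rkhs
begin

section \<open>Real inner product and Cauchy-Schwarz inequality\<close>

definition ker :: "'a \<Rightarrow> 'a \<Rightarrow> complex" where
  "ker w = (\<lambda>z. if z \<in> X then K z w else 0)"

text \<open>Only real parts are integrated later, so a real inner product suffices and no complex
  phase has to be adjusted.\<close>

definition rip :: "('a \<Rightarrow> complex) \<Rightarrow> ('a \<Rightarrow> complex) \<Rightarrow> real" where
  "rip f g = Re (ip f g)"

lemma ker_mem: "w \<in> X \<Longrightarrow> ker w \<in> H"
  unfolding ker_def by (rule kernel_mem)

lemma diff_mem: "f \<in> H \<Longrightarrow> g \<in> H \<Longrightarrow> (\<lambda>x. f x - g x) \<in> H"
  using add_mem[of f "\<lambda>x. -1 * g x"] scale_mem[of g "-1"] by simp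

lemma rip_add_left: "f \<in> H \<Longrightarrow> g \<in> H \<Longrightarrow> h \<in> H \<Longrightarrow> rip (\<lambda>x. f x + g x) h = rip f h + rip g h"
  by (simp add: rip_def ip_add_left)

lemma rip_scale_left:
  "f \<in> H \<Longrightarrow> g \<in> H \<Longrightarrow> rip (\<lambda>x. complex_of_real c * f x) g = c * rip f g"
  by (simp add: rip_def ip_scale_left)

lemma rip_commute: "f \<in> H \<Longrightarrow> g \<in> H \<Longrightarrow> rip f g = rip g f"
  using ip_cnj[of f g] by (simp add: rip_def)

lemma rip_nonneg: "f \<in> H \<Longrightarrow> 0 \<le> rip f f"
proof (cases "f = (\<lambda>x. 0)")
  case True
  have "ip (\<lambda>x. 0) (\<lambda>x. 0) = 0"
    using ip_scale_left[OF zero_mem zero_mem, of 0] by simp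
  then show ?thesis using True by (simp add: rip_def)
next
  case False
  assume "f \<in> H"
  with False ip_pos show ?thesis by (simp add: rip_def less_imp_le)
qed

lemma rip_expand:
  assumes "f \<in> H" "g \<in> H"
  shows "rip (\<lambda>x. f x + complex_of_real t * g x) (\<lambda>x. f x + complex_of_real t * g x)
    = rip f f + 2 * t * rip f g + t\<^sup>2 * rip g g"
proof -
  have tg: "(\<lambda>x. complex_of_real t * g x) \<in> H" using assms(2) by (rule scale_mem)
  have k: "(\<lambda>x. f x + complex_of_real t * g x) \<in> H" using assms(1) tg by (rule add_mem)
  have "rip f (\<lambda>x. f x + complex_of_real t * g x) = rip f f + t * rip f g"
    using assms tg k
    by (simp add: rip_commute[OF assms(1) k] rip_add_left rip_scale_left rip_commute[of g f])
  moreover have "rip g (\<lambda>x. f x + complex_of_real t * g x) = rip f g + t * rip g g"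
    using assms tg k
    by (simp add: rip_commute[OF assms(2) k] rip_add_left rip_scale_left)
  moreover have "rip (\<lambda>x. f x + complex_of_real t * g x) (\<lambda>x. f x + complex_of_real t * g x)
      = rip f (\<lambda>x. f x + complex_of_real t * g x) + t * rip g (\<lambda>x. f x + complex_of_real t * g x)"
    using assms tg k by (simp add: rip_add_left rip_scale_left)
  ultimately show ?thesis by (simp add: algebra_simps power2_eq_square)
qed

lemma rip_Cauchy_Schwarz:
  assumes "f \<in> H" "g \<in> H"
  shows "(rip f g)\<^sup>2 \<le> rip f f * rip g g"
proof (rule quadratic_nonneg_imp)
  fix t
  have "(\<lambda>x. f x + complex_of_real t * g x) \<in> H" using assms by (intro add_mem scale_mem)
  from rip_nonneg[OF this] show "0 \<le> rip f f + 2 * t * rip f g + t\<^sup>2 * rip g g"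
    unfolding rip_expand[OF assms] .
qed (use assms rip_nonneg in auto)

text \<open>\<open>ip\<close> is conjugate-linear in its second argument, hence the conjugate of
  \<open>c\<close>. The choice \<open>c = f w\<close> yields the squared modulus of
  \<open>f w\<close>.\<close>

lemma rip_kernel:
  assumes "f \<in> H" "w \<in> X"
  shows "rip f (\<lambda>x. c * ker w x) = Re (cnj c * f w)"
proof -
  have "ip f (\<lambda>x. c * ker w x) = cnj (ip (\<lambda>x. c * ker w x) f)"
    using assms by (intro ip_cnj scale_mem ker_mem)
  also have "\<dots> = cnj (c * ip (ker w) f)"
    using assms by (simp add: ip_scale_left ker_mem)
  also have "\<dots> = cnj c * ip f (ker w)"
    using ip_cnj[OF assms(1) ker_mem[OF assms(2)]] by simp
  also have "ip f (ker w) = f w"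
    using reproducing[OF assms] by (simp add: ker_def)
  finally show ?thesis by (simp add: rip_def)
qed

section \<open>Finite combinations of kernel functions\<close>

lemma weighted_kernel_sum_mem:
  assumes "finite Y" "Y \<subseteq> X"
  shows "(\<lambda>x. \<Sum>y\<in>Y. c y * ker y x) \<in> H"
  using assms by (induction Y rule: finite_induct) (auto intro!: zero_mem add_mem scale_mem ker_mem)

lemma rip_weighted_kernel_sum:
  fixes c :: "'a \<Rightarrow> real"
  assumes "finite Y" "Y \<subseteq> X" "f \<in> H"
  shows "rip f (\<lambda>x. \<Sum>y\<in>Y. complex_of_real (c y) * ker y x) = (\<Sum>y\<in>Y. c y * Re (f y))"
  using assms
proof (induction Y rule: finite_induct)
  case empty
  have "rip (\<lambda>x. 0) f = 0" using rip_scale_left[of f f 0] rip_scale_left[OF zero_mem, of f 0] empty by simp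
  then show ?case using rip_commute[OF _ zero_mem] empty by simp
next
  case (insert y Y)
  let ?u = "\<lambda>x. complex_of_real (c y) * ker y x" and ?v = "\<lambda>x. \<Sum>y\<in>Y. complex_of_real (c y) * ker y x"
  have u: "?u \<in> H" using insert by (intro scale_mem ker_mem) auto
  have v: "?v \<in> H" using insert by (intro weighted_kernel_sum_mem) auto
  have "rip f (\<lambda>x. ?u x + ?v x) = rip f ?u + rip f ?v"
    using rip_add_left[OF u v insert.prems(2)] rip_commute insert.prems(2) u v add_mem[OF u v] by simp
  moreover have "rip f ?u = c y * Re (f y)"
    using insert by (subst rip_kernel) auto
  ultimately show ?case using insert by simp
qed

text \<open>Cauchy-Schwarz against the potential of the discrete measure with mass
  \<open>c y\<close> at \<open>y\<close>: pairing with the potential integrates \<open>Re f\<close>,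
  and the squared norm of the potential is the discrete energy on the right.\<close>

lemma evaluation_sum_bound:
  fixes c :: "'a \<Rightarrow> real"
  assumes "finite Y" "Y \<subseteq> X" "f \<in> H"
  shows "(\<Sum>y\<in>Y. c y * Re (f y))\<^sup>2
    \<le> rip f f * (\<Sum>x\<in>Y. c x * (\<Sum>y\<in>Y. c y * Re (K x y)))"
proof -
  let ?u = "\<lambda>x. \<Sum>y\<in>Y. complex_of_real (c y) * ker y x"
  have u: "?u \<in> H" using assms by (intro weighted_kernel_sum_mem)
  have "rip ?u ?u = (\<Sum>x\<in>Y. c x * Re (?u x))"
    using assms(1,2) u by (rule rip_weighted_kernel_sum)
  also have "\<dots> = (\<Sum>x\<in>Y. c x * (\<Sum>y\<in>Y. c y * Re (K x y)))"
    using assms by (intro sum.cong refl) (auto simp: ker_def subset_iff)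
  finally show ?thesis
    using rip_Cauchy_Schwarz[OF assms(3) u] rip_weighted_kernel_sum[OF assms] by simp
qed

text \<open>Complex coefficients let the real inner product detect whole function values. The
  inductive form supports the later extension of every element to the closed ball.\<close>

inductive_set kernel_span :: "('a \<Rightarrow> complex) set" where
  scaled_ker: "w \<in> X \<Longrightarrow> (\<lambda>x. c * ker w x) \<in> kernel_span"
| add: "f \<in> kernel_span \<Longrightarrow> g \<in> kernel_span \<Longrightarrow> (\<lambda>x. f x + g x) \<in> kernel_span"

lemma kernel_span_mem: "q \<in> kernel_span \<Longrightarrow> q \<in> H"
  by (induction rule: kernel_span.induct) (auto intro: scale_mem ker_mem add_mem)

lemma kernel_span_scale: "q \<in> kernel_span \<Longrightarrow> (\<lambda>x. a * q x) \<in> kernel_span"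
proof (induction rule: kernel_span.induct)
  case (scaled_ker w c)
  then show ?case using kernel_span.scaled_ker[of w "a * c"] by (simp add: mult.assoc)
next
  case (add f g)
  then show ?case using kernel_span.add[OF add.IH] by (simp add: distrib_left)
qed

lemma parallelogram:
  assumes "f \<in> H" "g \<in> H"
  shows "rip (\<lambda>x. f x - g x) (\<lambda>x. f x - g x) + rip (\<lambda>x. f x + g x) (\<lambda>x. f x + g x)
    = 2 * rip f f + 2 * rip g g"
  using rip_expand[OF assms, of 1] rip_expand[OF assms, of "-1"] by simp

text \<open>
  The errors \<open>h - q\<close> along a minimizing sequence are Cauchy and become orthogonal to every
  kernel function, so their limit vanishes at every point.
\<close>

lemma kernel_span_dense:
  assumes h: "h \<in> H" and "X \<noteq> {}" "0 < \<epsilon>"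
  shows "\<exists>q\<in>kernel_span. rip (\<lambda>x. h x - q x) (\<lambda>x. h x - q x) < \<epsilon>"
proof -
  define N where "N q = rip (\<lambda>x. h x - q x) (\<lambda>x. h x - q x)" for q
  \<comment> \<open>\<open>d\<close> is the squared distance from \<open>h\<close> to the span; it
    is approached by near-minimizers \<open>q k\<close> with errors \<open>e k\<close>.\<close>
  define d where "d = (INF q\<in>kernel_span. N q)"
  have mem: "(\<lambda>x. h x - q x) \<in> H" if "q \<in> kernel_span" for q
    using h kernel_span_mem[OF that] by (rule diff_mem)
  have bdd: "bdd_below (N ` kernel_span)"
    by (rule bdd_belowI[of _ 0]) (auto simp: N_def intro: rip_nonneg mem)
  obtain w0 where "w0 \<in> X" using assms by auto
  then have ne: "kernel_span \<noteq> {}" using scaled_ker by blast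
  have d_le: "d \<le> N q" if "q \<in> kernel_span" for q
    unfolding d_def using bdd that by (rule cINF_lower)
  have "\<exists>q\<in>kernel_span. N q < d + 1 / real (Suc k)" for k
    using cINF_less_iff[OF ne bdd, of "d + 1 / real (Suc k)"] by (simp add: d_def)
  then obtain q where q: "\<And>k. q k \<in> kernel_span" and Nq: "\<And>k. N (q k) < d + 1 / real (Suc k)"
    by metis
  define e where "e k = (\<lambda>x. h x - q k x)" for k
  have e: "e k \<in> H" for k unfolding e_def by (rule mem[OF q])
  have Ne: "rip (e k) (e k) < d + 1 / real (Suc k)" for k
    using Nq by (simp add: N_def e_def)
  have cauchy: "rip (\<lambda>x. e m x - e n x) (\<lambda>x. e m x - e n x) \<le> 2 / real (Suc m) + 2 / real (Suc n)" for m n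
  proof -
    \<comment> \<open>The midpoint of \<open>q m\<close> and \<open>q n\<close> lies in the span, so
      its error has squared norm at least \<open>d\<close>. In the parallelogram law only the
      excesses over \<open>d\<close> then remain.\<close>
    let ?q = "\<lambda>x. (1/2) * (q m x + q n x)"
    have qs: "?q \<in> kernel_span" by (intro kernel_span_scale kernel_span.add q)
    have "rip (\<lambda>x. e m x + e n x) (\<lambda>x. e m x + e n x) = 4 * N ?q"
    proof -
      have eq: "(\<lambda>x. e m x + e n x) = (\<lambda>x. complex_of_real 2 * (h x - ?q x))"
        by (auto simp: e_def algebra_simps)
      have m2: "(\<lambda>x. h x - ?q x) \<in> H" by (rule mem[OF qs])
      have "(\<lambda>x. complex_of_real 2 * (h x - ?q x)) \<in> H" by (rule scale_mem[OF m2])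
      then show ?thesis
        unfolding eq N_def using m2
        by (simp only: rip_scale_left rip_commute[of "\<lambda>x. h x - ?q x" "\<lambda>x. complex_of_real 2 * (h x - ?q x)"])
    qed
    with parallelogram[OF e[of m] e[of n]] Ne[of m] Ne[of n] d_le[OF qs] show ?thesis
      by linarith
  qed
  have small: "\<exists>N. \<forall>n\<ge>N. C / real (Suc n) < \<delta>" if "0 < \<delta>" for \<delta> C :: real
  proof -
    have "(\<lambda>n. C / real (Suc n)) \<longlonglongrightarrow> 0"
      using LIMSEQ_Suc[OF lim_const_over_n[of C]] by simp
    from order_tendstoD(2)[OF this that] show ?thesis
      by (simp add: eventually_sequentially)
  qed
  have "\<exists>N. \<forall>m\<ge>N. \<forall>n\<ge>N. ip_dist ip (e m) (e n) < \<delta>" if "0 < \<delta>" for \<delta>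
  proof -
    have "0 < \<delta>\<^sup>2 / 2" using that by simp
    from small[OF this, of 2] obtain N where N: "\<And>n. n \<ge> N \<Longrightarrow> 2 / real (Suc n) < \<delta>\<^sup>2 / 2"
      by blast
    have "ip_dist ip (e m) (e n) < \<delta>" if "m \<ge> N" "n \<ge> N" for m n
    proof -
      have "rip (\<lambda>x. e m x - e n x) (\<lambda>x. e m x - e n x) < \<delta>\<^sup>2"
        using cauchy[of m n] N[OF that(1)] N[OF that(2)] by linarith
      then have "sqrt (rip (\<lambda>x. e m x - e n x) (\<lambda>x. e m x - e n x)) < sqrt (\<delta>\<^sup>2)"
        by (rule real_sqrt_less_mono)
      then show ?thesis using \<open>0 < \<delta>\<close> by (simp add: ip_dist_def ip_norm_def rip_def)
    qed
    then show ?thesis by blast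
  qed
  from complete[OF e this] obtain g where g: "g \<in> H" and lim: "(\<lambda>k. ip_dist ip (e k) g) \<longlonglongrightarrow> 0"
    by blast
  \<comment> \<open>Moving \<open>q k\<close> by a multiple of \<open>u\<close> cannot bring the
    squared distance below \<open>d\<close>, and \<open>e k\<close> exceeds \<open>d\<close> by less
    than \<open>1 / real (Suc k)\<close>. So the quadratic in \<open>t\<close> with this excess as
    constant term is nonnegative.\<close>
  have orth: "(rip (e k) u)\<^sup>2 \<le> (1 / real (Suc k)) * rip u u" if u: "u \<in> kernel_span" for k u
  proof (rule quadratic_nonneg_imp)
    fix t :: real
    have "(\<lambda>x. q k x + complex_of_real (-t) * u x) \<in> kernel_span"
      by (intro kernel_span.add kernel_span_scale q u)
    from d_le[OF this]
    have "d \<le> rip (\<lambda>x. e k x + complex_of_real t * u x) (\<lambda>x. e k x + complex_of_real t * u x)"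
      by (simp add: N_def e_def algebra_simps)
    then show "0 \<le> 1 / real (Suc k) + 2 * t * rip (e k) u + t\<^sup>2 * rip u u"
      using rip_expand[OF e[of k] kernel_span_mem[OF u], of t] Ne[of k] by linarith
  qed (use rip_nonneg kernel_span_mem u in auto)
  have "rip g u = 0" if u: "u \<in> kernel_span" for u
  proof -
    have uH: "u \<in> H" by (rule kernel_span_mem[OF u])
    have "(\<lambda>k. rip (e k) u) \<longlonglongrightarrow> 0"
    proof (rule tendsto_0_le)
      show "(\<lambda>k. sqrt (rip u u / real (Suc k))) \<longlonglongrightarrow> 0"
        using tendsto_real_sqrt[OF LIMSEQ_Suc[OF lim_const_over_n[of "rip u u"]]] by simp
      show "\<forall>\<^sub>F k in sequentially. norm (rip (e k) u) \<le> norm (sqrt (rip u u / real (Suc k))) * 1"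
      proof (intro always_eventually allI)
        fix k
        have "\<bar>rip (e k) u\<bar> \<le> sqrt (rip u u / real (Suc k))"
          using orth[OF u, of k] by (intro real_le_rsqrt) simp
        then show "norm (rip (e k) u) \<le> norm (sqrt (rip u u / real (Suc k))) * 1" by simp
      qed
    qed
    moreover have "(\<lambda>k. rip (e k) u) \<longlonglongrightarrow> rip g u"
    proof -
      have "(\<lambda>k. rip (\<lambda>x. e k x - g x) u) \<longlonglongrightarrow> 0"
      proof (rule tendsto_0_le[OF lim])
        show "\<forall>\<^sub>F k in sequentially. norm (rip (\<lambda>x. e k x - g x) u)
            \<le> norm (ip_dist ip (e k) g) * sqrt (rip u u)"
        proof (intro always_eventually allI)
          fix k
          have m: "(\<lambda>x. e k x - g x) \<in> H" by (rule diff_mem[OF e g])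
          have "\<bar>rip (\<lambda>x. e k x - g x) u\<bar>
              \<le> sqrt (rip (\<lambda>x. e k x - g x) (\<lambda>x. e k x - g x) * rip u u)"
            using rip_Cauchy_Schwarz[OF m uH] by (intro real_le_rsqrt) simp
          then show "norm (rip (\<lambda>x. e k x - g x) u) \<le> norm (ip_dist ip (e k) g) * sqrt (rip u u)"
            using rip_nonneg[OF m] by (simp add: real_sqrt_mult ip_dist_def ip_norm_def rip_def)
        qed
      qed
      moreover have "rip (\<lambda>x. e k x - g x) u = rip (e k) u - rip g u" for k
        using rip_add_left[OF e[of k] scale_mem[OF g, of "-1"] uH] rip_scale_left[OF g uH, of "-1"]
        by simp
      ultimately show ?thesis by (simp add: LIM_zero_iff)
    qed
    ultimately show ?thesis by (rule LIMSEQ_unique[symmetric])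
  qed
  note orth0 = this
  have "g w = 0" for w
  proof (cases "w \<in> X")
    case True
    \<comment> \<open>Orthogonality to \<open>g w\<close> times the kernel function at
      \<open>w\<close> says that the squared modulus of \<open>g w\<close> vanishes.\<close>
    have "Re (cnj (g w) * g w) = 0"
      using orth0[OF scaled_ker[OF True, of "g w"]] rip_kernel[OF g True, of "g w"] by simp
    then show ?thesis
      by (simp add: complex_eq_iff sum_squares_eq_zero_iff)
  qed (use outside g in auto)
  then have "g = (\<lambda>x. 0)" by auto
  \<comment> \<open>As the limit is zero, the errors tend to 0 in norm, and a late
    \<open>q k\<close> is the required approximation.\<close>
  with lim have "(\<lambda>k. sqrt (rip (e k) (e k))) \<longlonglongrightarrow> 0"
    by (simp add: ip_dist_def ip_norm_def rip_def)
  from order_tendstoD(2)[OF this, of "sqrt \<epsilon>"] assms(3)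
  obtain k where "sqrt (rip (e k) (e k)) < sqrt \<epsilon>"
    by (auto simp: eventually_sequentially)
  then show ?thesis using q[of k] by (auto simp: e_def)
qed

end


section \<open>Averaging point evaluations\<close>

text \<open>Arbitrary simple approximants may leave \<open>C\<close>. Composing them with the
  closest-point projection keeps them simple and, since the projection is continuous and fixes
  \<open>C\<close>, preserves the limit.\<close>

lemma simple_approximation:
  fixes \<phi> :: "'b \<Rightarrow> 'a::euclidean_space"
  assumes "closed C" "convex C" "C \<noteq> {}" "\<phi> \<in> borel_measurable M" "\<And>x. x \<in> space M \<Longrightarrow> \<phi> x \<in> C"
  obtains F where "\<And>i::nat. simple_function M (F i)" "\<And>i x. F i x \<in> C"
    "\<And>x. x \<in> space M \<Longrightarrow> (\<lambda>i. F i x) \<longlonglongrightarrow> \<phi> x"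
proof -
  obtain F where F: "\<And>i::nat. simple_function M (F i)"
    "\<And>x. x \<in> space M \<Longrightarrow> (\<lambda>i. F i x) \<longlonglongrightarrow> \<phi> x"
    using borel_measurable_implies_sequence_metric[OF assms(4), of 0] by blast
  show thesis
  proof
    show "simple_function M (\<lambda>x. closest_point C (F i x))" for i
      using simple_function_compose[OF F(1), of "closest_point C" i] by (simp add: comp_def)
    show "closest_point C (F i x) \<in> C" for i x
      using assms by (intro closest_point_in_set)
    show "(\<lambda>i. closest_point C (F i x)) \<longlonglongrightarrow> \<phi> x" if x: "x \<in> space M" for x
    proof -
      have "isCont (closest_point C) (\<phi> x)"
        using assms by (intro continuous_at_closest_point)
      then have "(\<lambda>i. closest_point C (F i x)) \<longlonglongrightarrow> closest_point C (\<phi> x)"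
        using F(2)[OF x] by (rule isCont_tendsto_compose)
      then show ?thesis using assms(5)[OF x] by (simp add: closest_point_self)
    qed
  qed
qed

text \<open>Splitting the space into the level sets of \<open>s\<close> turns integrals into the
  weighted sums of \<open>evaluation_sum_bound\<close>.\<close>

lemma integral_simple_compose:
  fixes G :: "'a \<Rightarrow> real"
  assumes "finite_measure M" "simple_function M s"
  shows "(\<integral>x. G (s x) \<partial>M) = (\<Sum>y\<in>s ` space M. measure M (s -` {y} \<inter> space M) * G y)"
proof -
  interpret finite_measure M by fact
  have fin: "finite (s ` space M)" using assms(2) by (rule simple_functionD)
  have sets: "s -` {y} \<inter> space M \<in> sets M" for y using assms(2) by (rule simple_functionD)
  have "(\<integral>x. G (s x) \<partial>M)
      = (\<integral>x. (\<Sum>y\<in>s ` space M. indicator (s -` {y} \<inter> space M) x * G y) \<partial>M)"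
  proof (rule Bochner_Integration.integral_cong)
    fix x assume x: "x \<in> space M"
    have "(\<Sum>y\<in>s ` space M. indicator (s -` {y} \<inter> space M) x * G y)
        = (\<Sum>y\<in>s ` space M. if y = s x then G y else 0)"
      using x by (intro sum.cong) (auto simp: indicator_def)
    also have "\<dots> = G (s x)" using fin x by simp
    finally show "G (s x) = (\<Sum>y\<in>s ` space M. indicator (s -` {y} \<inter> space M) x * G y)" ..
  qed simp
  also have "\<dots> = (\<Sum>y\<in>s ` space M. measure M (s -` {y} \<inter> space M) * G y)"
    using sets by (subst Bochner_Integration.integral_sum) (auto simp: emeasure_eq_measure)
  finally show ?thesis .
qed

lemma bounded_convergence:
  fixes l :: "'a \<Rightarrow> real"
  assumes "finite_measure M" "\<And>i::nat. u i \<in> borel_measurable M"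
    "\<And>i x. x \<in> space M \<Longrightarrow> \<bar>u i x\<bar> \<le> B" "\<And>x. x \<in> space M \<Longrightarrow> (\<lambda>i. u i x) \<longlonglongrightarrow> l x"
  shows "(\<lambda>i. \<integral>x. u i x \<partial>M) \<longlonglongrightarrow> (\<integral>x. l x \<partial>M)"
proof -
  interpret finite_measure M by fact
  have "l \<in> borel_measurable M"
    using assms(4,2) by (rule borel_measurable_LIMSEQ_real)
  then show ?thesis
    using assms by (intro integral_dominated_convergence[where w = "\<lambda>_. B"]) auto
qed

lemma compact_continuous_bound:
  fixes u :: "'a::metric_space \<Rightarrow> 'b::real_normed_vector"
  assumes "compact C" "continuous_on C u"
  obtains B where "\<And>x. x \<in> C \<Longrightarrow> norm (u x) \<le> B"
proof -
  have "bounded (u ` C)" using compact_continuous_image[OF assms(2,1)] by (rule compact_imp_bounded)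
  then show thesis using that by (auto simp: bounded_iff)
qed

text \<open>For simple \<open>\<phi>\<close> this is the bound for finite sums, with the masses of
  the level sets as weights. The general case follows by approximation inside the compact set
  \<open>C\<close>, where \<open>h\<close> and \<open>K\<close> are bounded and continuous.\<close>

lemma evaluation_integral_bound:
  fixes X :: "'a::euclidean_space set"
  assumes "rkhs X K H ip" and h: "h \<in> H" and M: "finite_measure M"
    and \<phi>: "\<phi> \<in> borel_measurable M" "\<And>x. x \<in> space M \<Longrightarrow> \<phi> x \<in> C"
    and C: "compact C" "convex C" "C \<subseteq> X"
    and cont_h: "continuous_on C h" and cont_K: "continuous_on (C \<times> C) (\<lambda>(x, y). K x y)"
  shows "(\<integral>x. Re (h (\<phi> x)) \<partial>M)\<^sup>2 \<le> Re (ip h h) * (\<integral>x. (\<integral>y. Re (K (\<phi> x) (\<phi> y)) \<partial>M) \<partial>M)"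
proof (cases "C = {}")
  case True
  with \<phi> have "space M = {}" by auto
  then have "(\<integral>x. g x \<partial>M) = 0" for g :: "_ \<Rightarrow> real"
    by (intro integral_eq_zero_AE) (auto intro: AE_I2)
  then show ?thesis by simp
next
  case False
  interpret rkhs X K H ip by fact
  interpret finite_measure M by fact
  obtain F where F: "\<And>i::nat. simple_function M (F i)" "\<And>i x. F i x \<in> C"
    and lim: "\<And>x. x \<in> space M \<Longrightarrow> (\<lambda>i. F i x) \<longlonglongrightarrow> \<phi> x"
    using simple_approximation[OF compact_imp_closed[OF C(1)] C(2) False \<phi>] by blast
  have meas: "(\<lambda>x. G (F i x)) \<in> borel_measurable M" for G :: "'a \<Rightarrow> real" and i
    using simple_function_compose[OF F(1), of G i]
    by (intro borel_measurable_simple_function) (simp add: comp_def)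
  obtain Bh where Bh: "\<And>x. x \<in> C \<Longrightarrow> norm (h x) \<le> Bh"
    using compact_continuous_bound[OF C(1) cont_h] by blast
  obtain BK where BK: "\<And>z. z \<in> C \<times> C \<Longrightarrow> norm ((\<lambda>(x, y). K x y) z) \<le> BK"
    using compact_continuous_bound[OF compact_Times[OF C(1) C(1)] cont_K] by blast
  have BK': "\<bar>Re (K x y)\<bar> \<le> BK" if "x \<in> C" "y \<in> C" for x y
    using BK[of "(x, y)"] that abs_Re_le_cmod[of "K x y"] by simp
  have Bh': "\<bar>Re (h x)\<bar> \<le> Bh" if "x \<in> C" for x
    using Bh[of x] that abs_Re_le_cmod[of "h x"] by simp
  have lim_h: "(\<lambda>i. \<integral>x. Re (h (F i x)) \<partial>M) \<longlonglongrightarrow> (\<integral>x. Re (h (\<phi> x)) \<partial>M)"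
  proof (rule bounded_convergence[OF M meas])
    show "\<bar>Re (h (F i x))\<bar> \<le> Bh" for i x by (rule Bh'[OF F(2)])
    show "(\<lambda>i. Re (h (F i x))) \<longlonglongrightarrow> Re (h (\<phi> x))" if "x \<in> space M" for x
      using F(2) \<phi>(2)[OF that] lim[OF that]
      by (intro tendsto_Re continuous_on_tendsto_compose[OF cont_h]) auto
  qed
  \<comment> \<open>Bounded convergence is applied twice: to the inner integral for each fixed
    \<open>x\<close>, then to the outer one with bound \<open>BK\<close> times the total
    mass.\<close>
  have lim_K: "(\<lambda>i. \<integral>x. (\<integral>y. Re (K (F i x) (F i y)) \<partial>M) \<partial>M)
      \<longlonglongrightarrow> (\<integral>x. (\<integral>y. Re (K (\<phi> x) (\<phi> y)) \<partial>M) \<partial>M)"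
  proof (rule bounded_convergence[OF M])
    show "(\<lambda>x. \<integral>y. Re (K (F i x) (F i y)) \<partial>M) \<in> borel_measurable M" for i
      by (rule meas)
    show "\<bar>\<integral>y. Re (K (F i x) (F i y)) \<partial>M\<bar> \<le> BK * measure M (space M)" for i x
    proof -
      have "norm (\<integral>y. Re (K (F i x) (F i y)) \<partial>M) \<le> (\<integral>y. BK \<partial>M)"
      proof (intro order_trans[OF integral_norm_bound] integral_mono integrable_norm)
        show "integrable M (\<lambda>y. Re (K (F i x) (F i y)))"
          using BK'[OF F(2) F(2)] by (intro integrable_const_bound[where B = BK] meas AE_I2) auto
      qed (use BK'[OF F(2) F(2)] in auto)
      then show ?thesis by (simp add: mult.commute)
    qed
    show "(\<lambda>i. \<integral>y. Re (K (F i x) (F i y)) \<partial>M) \<longlonglongrightarrow> (\<integral>y. Re (K (\<phi> x) (\<phi> y)) \<partial>M)"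
      if x: "x \<in> space M" for x
    proof (rule bounded_convergence[OF M meas])
      show "\<bar>Re (K (F i x) (F i y))\<bar> \<le> BK" for i y by (rule BK'[OF F(2) F(2)])
      fix y assume y: "y \<in> space M"
      have "(\<lambda>i. (\<lambda>(x, y). K x y) (F i x, F i y)) \<longlonglongrightarrow> (\<lambda>(x, y). K x y) (\<phi> x, \<phi> y)"
        using F(2) \<phi>(2)[OF x] \<phi>(2)[OF y] lim[OF x] lim[OF y]
        by (intro continuous_on_tendsto_compose[OF cont_K] tendsto_Pair) auto
      then show "(\<lambda>i. Re (K (F i x) (F i y))) \<longlonglongrightarrow> Re (K (\<phi> x) (\<phi> y))"
        by (intro tendsto_Re) simp
    qed
  qed
  have "(\<integral>x. Re (h (F i x)) \<partial>M)\<^sup>2 \<le> Re (ip h h) * (\<integral>x. (\<integral>y. Re (K (F i x) (F i y)) \<partial>M) \<partial>M)" for i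
  proof -
    let ?Y = "F i ` space M" and ?c = "\<lambda>y. measure M (F i -` {y} \<inter> space M)"
    have "finite ?Y" using F(1) by (rule simple_functionD)
    moreover have "?Y \<subseteq> X" using F(2) C(3) by auto
    ultimately show ?thesis
      using evaluation_sum_bound[of ?Y h ?c] h
      unfolding integral_simple_compose[OF M F(1)[of i], of "\<lambda>x. Re (h x)"]
        integral_simple_compose[OF M F(1)[of i], of "\<lambda>y. Re (K x y)" for x]
        integral_simple_compose[OF M F(1)[of i], of "\<lambda>x. \<Sum>y\<in>?Y. ?c y * Re (K x y)"]
      by (simp add: rip_def)
  qed
  then show ?thesis
    using lim_h lim_K by (intro LIMSEQ_le[OF tendsto_power tendsto_mult_left]) auto
qed


section \<open>Measures of finite energy on the sphere\<close>

lemma norm_hermitian_inner_le: "norm (hermitian_inner z w) \<le> norm z * norm w"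
proof -
  have "norm (hermitian_inner z w) \<le> (\<Sum>i\<in>UNIV. \<bar>norm (z $ i)\<bar> * \<bar>norm (w $ i)\<bar>)"
    unfolding hermitian_inner_def by (rule order_trans[OF norm_sum]) (simp add: norm_mult)
  also have "\<dots> \<le> norm z * norm w"
    unfolding norm_vec_def by (rule L2_set_mult_ineq)
  finally show ?thesis .
qed

text \<open>The denominator of the kernel does not vanish even if one argument lies on the sphere,
  so each kernel function is continuous on the closed ball.\<close>

lemma hermitian_inner_ne_1:
  fixes z w :: "complex ^ 'n"
  assumes "norm z \<le> 1" "norm w < 1"
  shows "hermitian_inner z w \<noteq> 1"
proof
  assume "hermitian_inner z w = 1"
  then have "1 \<le> norm z * norm w" using norm_hermitian_inner_le[of z w] by simp
  also have "\<dots> \<le> 1 * norm w" using assms by (intro mult_right_mono) auto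
  finally show False using assms by simp
qed

lemma continuous_on_da_kernel_diag:
  assumes "r < 1"
  shows "continuous_on (cball 0 r \<times> cball 0 (r::real) :: ((complex ^ 'n) \<times> (complex ^ 'n)) set) (\<lambda>(z, w). da_kernel z w)"
  unfolding da_kernel_def case_prod_beta hermitian_inner_def
proof (intro continuous_intros ballI)
  fix x :: "(complex ^ 'n) \<times> (complex ^ 'n)"
  assume "x \<in> cball 0 r \<times> cball 0 r"
  then have "hermitian_inner (fst x) (snd x) \<noteq> 1"
    using assms by (intro hermitian_inner_ne_1) auto
  then show "1 - (\<Sum>i\<in>UNIV. fst x $ i * cnj (snd x $ i)) \<noteq> 0"
    by (simp add: hermitian_inner_def)
qed

lemma continuous_on_da_kernel_cball:
  fixes w :: "complex ^ 'n"
  assumes "norm w < 1"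
  shows "continuous_on (cball 0 1) (\<lambda>z. da_kernel z w)"
  unfolding da_kernel_def hermitian_inner_def
proof (intro continuous_intros ballI)
  fix x :: "complex ^ 'n"
  assume "x \<in> cball 0 1"
  then have "hermitian_inner x w \<noteq> 1"
    using assms by (intro hermitian_inner_ne_1) auto
  then show "1 - (\<Sum>i\<in>UNIV. x $ i * cnj (w $ i)) \<noteq> 0"
    by (simp add: hermitian_inner_def)
qed

lemma sphere_probsD:
  assumes "\<mu> \<in> sphere_probs F"
  shows "prob_space \<mu>" "sets \<mu> = sets (restrict_space borel (sphere 0 1))"
    "space \<mu> = sphere 0 1" "emeasure \<mu> (sphere 0 1 - F) = 0"
  using assms sets_eq_imp_space_eq[of \<mu> "restrict_space borel (sphere 0 1)"]
  by (auto simp: sphere_probs_def space_restrict_space)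

lemma sphere_probs_measurable:
  fixes u :: "complex ^ 'n \<Rightarrow> 'b::topological_space"
  assumes "\<mu> \<in> sphere_probs F" "continuous_on (sphere 0 1) u"
  shows "u \<in> borel_measurable \<mu>"
  using borel_measurable_continuous_on_restrict[OF assms(2)] sphere_probsD(2)[OF assms(1)]
  by (simp cong: measurable_cong_sets)

lemma sphere_probs_set_integrable:
  fixes u :: "complex ^ 'n \<Rightarrow> real"
  assumes "\<mu> \<in> sphere_probs F" "continuous_on (sphere 0 1) u" "B \<in> sets \<mu>"
  shows "set_integrable \<mu> B u"
proof -
  interpret prob_space \<mu> using assms(1) by (rule sphere_probsD)
  obtain C where "\<And>x. x \<in> sphere 0 1 \<Longrightarrow> norm (u x) \<le> C"
    using compact_continuous_bound[OF compact_sphere assms(2)] by blast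
  then have "integrable \<mu> u"
    using sphere_probs_measurable[OF assms(1,2)] sphere_probsD(3)[OF assms(1)]
    by (intro integrable_const_bound[where B = C] AE_I2) auto
  then show ?thesis
    unfolding set_integrable_def using assms(3) by (intro integrable_mult_indicator)
qed

lemma sphere_probs_set_integral_const:
  assumes "\<mu> \<in> sphere_probs F" "B \<in> sets \<mu>"
  shows "(LINT x:B|\<mu>. c) = c * measure \<mu> B"
proof -
  interpret prob_space \<mu> using assms(1) by (rule sphere_probsD)
  show ?thesis
    using assms(2) by (simp add: set_lebesgue_integral_def mult.commute)
qed

lemma sphere_openin_sets:
  assumes "\<mu> \<in> sphere_probs F" "openin (top_of_set (sphere 0 1)) B"
  shows "B \<in> sets \<mu>"
proof -
  obtain T where "open T" "B = sphere 0 1 \<inter> T" using assms(2) by (auto simp: openin_open)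
  then show ?thesis
    using sphere_probsD(2)[OF assms(1)] by (auto simp: sets_restrict_space)
qed

text \<open>At \<open>r = 0\<close> the kernel is constantly 1, so this term of the supremum is the
  squared total mass. The bound later absorbs additive errors into the energy factor.\<close>

lemma da_energy_ge_1:
  assumes "\<mu> \<in> sphere_probs F"
  shows "1 \<le> da_energy \<mu>"
proof -
  interpret prob_space \<mu> using assms(1) by (rule sphere_probsD)
  have "1 = (\<integral>\<^sup>+ z. (\<integral>\<^sup>+ w. ennreal (Re (da_kernel (0 *\<^sub>R z) (0 *\<^sub>R w))) \<partial>\<mu>) \<partial>\<mu>)"
    by (simp add: da_kernel_def hermitian_inner_def emeasure_space_1)
  also have "\<dots> \<le> da_energy \<mu>"
    unfolding da_energy_def by (rule SUP_upper) simp
  finally show ?thesis .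
qed


section \<open>Radial dilations tested against measures of finite energy\<close>

lemma drury_arveson_continuous_on:
  fixes H :: "(complex ^ 'n \<Rightarrow> complex) set"
  assumes "drury_arveson H ip" "h \<in> H"
  shows "continuous_on (ball 0 1) h"
proof (rule continuous_at_imp_continuous_on, rule ballI)
  fix z :: "complex ^ 'n" assume "z \<in> ball 0 1"
  moreover have "holomorphic_vec_on h (ball 0 1)"
    using assms by (simp add: drury_arveson_def)
  ultimately obtain D where "(h has_derivative D) (at z)"
    unfolding holomorphic_vec_on_def by blast
  then show "isCont h z" by (rule has_derivative_continuous)
qed

lemma drury_arveson_dilation_continuous_on:
  fixes H :: "(complex ^ 'n \<Rightarrow> complex) set"
  assumes "drury_arveson H ip" "h \<in> H" "0 \<le> r" "r < 1"
  shows "continuous_on (sphere 0 1) (\<lambda>z. h (r *\<^sub>R z))"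
  using assms(3,4)
  by (intro continuous_on_compose2[OF drury_arveson_continuous_on[OF assms(1,2)]] continuous_intros)
    auto

text \<open>A Bochner integral is bounded by the nonnegative integral of the positive part, which
  only grows when \<open>B\<close> is enlarged to the whole sphere.\<close>

lemma double_integral_le_energy:
  fixes \<mu> :: "(complex ^ 'n) measure"
  assumes \<mu>: "\<mu> \<in> sphere_probs F" and B: "B \<in> sets \<mu>" and r: "0 \<le> r" "r < 1"
    and fin: "da_energy \<mu> < \<infinity>"
  shows "(\<integral>z. (\<integral>w. Re (da_kernel (r *\<^sub>R z) (r *\<^sub>R w)) \<partial>restrict_space \<mu> B) \<partial>restrict_space \<mu> B)
    \<le> enn2real (da_energy \<mu>)"
proof -
  define k where "k z w = Re (da_kernel (r *\<^sub>R z) (r *\<^sub>R w))" for z w :: "complex ^ 'n"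
  let ?M = "restrict_space \<mu> B"
  have B': "B \<inter> space \<mu> \<in> sets \<mu>" using B by auto
  have mono: "(\<integral>\<^sup>+ x. g x \<partial>?M) \<le> (\<integral>\<^sup>+ x. g x \<partial>\<mu>)" for g
    unfolding nn_integral_restrict_space[OF B'] by (intro nn_integral_mono) (auto simp: indicator_def)
  have inner: "ennreal (\<integral>w. k z w \<partial>?M) \<le> (\<integral>\<^sup>+ w. k z w \<partial>\<mu>)" for z
  proof (cases "(\<integral>\<^sup>+ w. k z w \<partial>\<mu>) = \<infinity>")
    case False
    then have *: "(\<integral>\<^sup>+ w. k z w \<partial>\<mu>) = ennreal (enn2real (\<integral>\<^sup>+ w. k z w \<partial>\<mu>))"
      by (simp add: less_top)
    have "(\<integral>w. k z w \<partial>?M) \<le> enn2real (\<integral>\<^sup>+ w. k z w \<partial>\<mu>)"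
      using mono[of "\<lambda>w. ennreal (k z w)"] * by (intro integral_real_bounded) auto
    then show ?thesis by (subst *) (rule ennreal_leI)
  qed simp
  have "(\<integral>\<^sup>+ z. ennreal (\<integral>w. k z w \<partial>?M) \<partial>?M) \<le> (\<integral>\<^sup>+ z. (\<integral>\<^sup>+ w. k z w \<partial>\<mu>) \<partial>\<mu>)"
    using inner by (intro order_trans[OF mono] nn_integral_mono)
  also have "\<dots> \<le> da_energy \<mu>"
    unfolding da_energy_def k_def using r by (intro SUP_upper) simp
  also have "\<dots> = ennreal (enn2real (da_energy \<mu>))"
    using fin by (simp add: less_top)
  finally show ?thesis
    unfolding k_def by (intro integral_real_bounded) auto
qed

text \<open>The averaged evaluation bound for the map \<open>z\<close> to \<open>r z\<close>, which
  sends the sphere into the compact ball \<open>cball 0 r\<close>. Admitting every measurable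
  \<open>B\<close> permits Chebyshev estimates on level sets.\<close>

lemma dilation_integral_bound:
  fixes H :: "(complex ^ 'n \<Rightarrow> complex) set"
  assumes da: "drury_arveson H ip" and h: "h \<in> H" and \<mu>: "\<mu> \<in> sphere_probs F" and B: "B \<in> sets \<mu>"
    and r: "0 \<le> r" "r < 1" and fin: "da_energy \<mu> < \<infinity>"
  shows "\<bar>LINT z:B|\<mu>. Re (h (r *\<^sub>R z))\<bar> \<le> sqrt (Re (ip h h)) * sqrt (enn2real (da_energy \<mu>))"
proof -
  interpret prob_space \<mu> using \<mu> by (rule sphere_probsD)
  have rk: "rkhs (ball 0 1) da_kernel H ip" using da by (simp add: drury_arveson_def)
  interpret rkhs "ball 0 1" da_kernel H ip by (rule rk)
  let ?M = "restrict_space \<mu> B"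
  have B': "B \<inter> space \<mu> \<in> sets \<mu>" using B by auto
  have sub: "B \<subseteq> sphere 0 1" using sets.sets_into_space[OF B] sphere_probsD(3)[OF \<mu>] by simp
  have sub_ball: "cball 0 r \<subseteq> (ball 0 1 :: (complex ^ 'n) set)" using r by auto
  have "(\<lambda>z. r *\<^sub>R z) \<in> borel_measurable \<mu>"
    by (intro sphere_probs_measurable[OF \<mu>] continuous_intros)
  then have "(\<lambda>z. r *\<^sub>R z) \<in> borel_measurable ?M" by (rule measurable_restrict_space1)
  moreover have "r *\<^sub>R z \<in> cball 0 r" if "z \<in> space ?M" for z
    using that sub r by (auto simp: space_restrict_space)
  ultimately have "(\<integral>z. Re (h (r *\<^sub>R z)) \<partial>?M)\<^sup>2 \<le> Re (ip h h) *
      (\<integral>z. (\<integral>w. Re (da_kernel (r *\<^sub>R z) (r *\<^sub>R w)) \<partial>?M) \<partial>?M)"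
    using r sub_ball continuous_on_subset[OF drury_arveson_continuous_on[OF da h] sub_ball]
    by (intro evaluation_integral_bound[OF rk h finite_measure_restrict_space[OF finite_measure_axioms B],
          where C = "cball 0 r"] continuous_on_da_kernel_diag) auto
  also have "\<dots> \<le> Re (ip h h) * enn2real (da_energy \<mu>)"
    using rip_nonneg[OF h] by (intro mult_left_mono double_integral_le_energy[OF \<mu> B r fin]) (simp add: rip_def)
  finally have "(LINT z:B|\<mu>. Re (h (r *\<^sub>R z)))\<^sup>2 \<le> Re (ip h h) * enn2real (da_energy \<mu>)"
    by (simp add: integral_restrict_space[OF B'] set_lebesgue_integral_def)
  then have "\<bar>LINT z:B|\<mu>. Re (h (r *\<^sub>R z))\<bar> \<le> sqrt (Re (ip h h) * enn2real (da_energy \<mu>))"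
    by (intro real_le_rsqrt) simp
  then show ?thesis by (simp add: real_sqrt_mult)
qed

text \<open>Each pole parameter \<open>w\<close> lies in the open ball, so the formula for the
  kernel function stays continuous up to the sphere. Compactness then gives uniform continuity along
  radii.\<close>

lemma kernel_span_extends_continuously:
  fixes q :: "complex ^ 'n \<Rightarrow> complex"
    and H :: "(complex ^ 'n \<Rightarrow> complex) set"
  assumes "rkhs (ball 0 1) da_kernel H ip" "q \<in> rkhs.kernel_span (ball 0 1) da_kernel"
  shows "\<exists>p. continuous_on (cball 0 1) p \<and> (\<forall>z\<in>ball 0 1. q z = p z)"
proof -
  interpret rkhs "ball 0 1" da_kernel H ip by fact
  from assms(2) show ?thesis
  proof (induction rule: kernel_span.induct)
    case (scaled_ker w c)
    then have "continuous_on (cball 0 1) (\<lambda>z. c * da_kernel z w)"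
      by (intro continuous_intros continuous_on_da_kernel_cball) simp
    then show ?case by (intro exI[of _ "\<lambda>z. c * da_kernel z w"]) (auto simp: ker_def)
  next
    case (add f g)
    then obtain p p' where "continuous_on (cball 0 1) p" "\<forall>z\<in>ball 0 1. f z = p z"
      "continuous_on (cball 0 1) p'" "\<forall>z\<in>ball 0 1. g z = p' z" by blast
    then show ?case
      by (intro exI[of _ "\<lambda>z. p z + p' z"] conjI continuous_intros) auto
  qed
qed

text \<open>An \<epsilon>/3 argument: \<open>h\<close> is an element \<open>q\<close> of the kernel
  span plus an error of norm at most \<epsilon>/3. The error is integrated at both radii by
  \<open>dilation_integral_bound\<close>, and \<open>q\<close> is uniformly continuous. Hence
  \<open>R\<close> depends only on \<open>h\<close> and \<epsilon>, not on the measure or the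
  set.\<close>

lemma dilation_increment_bound:
  fixes H :: "(complex ^ 'n \<Rightarrow> complex) set"
  assumes da: "drury_arveson H ip" and h: "h \<in> H" and "0 < \<epsilon>"
  shows "\<exists>R\<ge>0. R < 1 \<and> (\<forall>r s F \<mu> B. R \<le> r \<longrightarrow> r < 1 \<longrightarrow> R \<le> s \<longrightarrow> s < 1 \<longrightarrow> \<mu> \<in> sphere_probs F \<longrightarrow>
      B \<in> sets \<mu> \<longrightarrow> da_energy \<mu> < \<infinity> \<longrightarrow>
      (LINT z:B|\<mu>. Re (h (r *\<^sub>R z)) - Re (h (s *\<^sub>R z))) \<le> \<epsilon> * sqrt (enn2real (da_energy \<mu>)))"
proof -
  have rk: "rkhs (ball 0 1) da_kernel H ip" using da by (simp add: drury_arveson_def)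
  interpret rkhs "ball 0 1" da_kernel H ip by (rule rk)
  obtain q where q: "q \<in> kernel_span"
    and hq: "rip (\<lambda>x. h x - q x) (\<lambda>x. h x - q x) < (\<epsilon> / 3)\<^sup>2"
    using kernel_span_dense[OF h, of "(\<epsilon> / 3)\<^sup>2"] \<open>0 < \<epsilon>\<close> by auto
  let ?e = "\<lambda>x. h x - q x"
  have e: "?e \<in> H" using h kernel_span_mem[OF q] by (rule diff_mem)
  have Ne: "sqrt (Re (ip ?e ?e)) \<le> \<epsilon> / 3"
    using hq \<open>0 < \<epsilon>\<close> by (intro real_le_lsqrt) (auto simp: rip_def)
  obtain p where p: "continuous_on (cball 0 1) p" "\<And>z. z \<in> ball 0 1 \<Longrightarrow> q z = p z"
    using kernel_span_extends_continuously[OF rk q] by blast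
  obtain \<delta> where \<delta>: "\<delta> > 0"
    "\<And>x y. x \<in> cball 0 1 \<Longrightarrow> y \<in> cball 0 1 \<Longrightarrow> dist y x < \<delta> \<Longrightarrow> dist (p y) (p x) < \<epsilon> / 3"
    using compact_uniformly_continuous[OF p(1) compact_cball] \<open>0 < \<epsilon>\<close>
    unfolding uniformly_continuous_on_def by (metis divide_pos_pos zero_less_numeral)
  \<comment> \<open>Any two radii in \<open>[R, 1)\<close> differ by less than \<delta>.\<close>
  define R where "R = max 0 (1 - \<delta>)"
  have "(LINT z:B|\<mu>. Re (h (r *\<^sub>R z)) - Re (h (s *\<^sub>R z))) \<le> \<epsilon> * sqrt (enn2real (da_energy \<mu>))"
    if r: "R \<le> r" "r < 1" and s: "R \<le> s" "s < 1" and \<mu>: "\<mu> \<in> sphere_probs F" and B: "B \<in> sets \<mu>"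
      and fin: "da_energy \<mu> < \<infinity>" for r s F \<mu> B
  proof -
    interpret prob_space \<mu> using \<mu> by (rule sphere_probsD)
    let ?E = "sqrt (enn2real (da_energy \<mu>))"
    have r0: "0 \<le> r" "0 \<le> s" using r s by (auto simp: R_def)
    \<comment> \<open>Since \<open>measure \<mu> B\<close> is at most 1, this turns the pointwise
      bound for \<open>q\<close> into a multiple of \<open>?E\<close>.\<close>
    have E: "1 \<le> ?E"
    proof -
      have "enn2real 1 \<le> enn2real (da_energy \<mu>)"
        using da_energy_ge_1[OF \<mu>] fin by (intro enn2real_mono) auto
      then show ?thesis by simp
    qed
    have sub: "B \<subseteq> sphere 0 1" using sets.sets_into_space[OF B] sphere_probsD(3)[OF \<mu>] by simp
    note dil = drury_arveson_dilation_continuous_on[OF da]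
    note int = sphere_probs_set_integrable[OF \<mu> _ B]
    have qH: "q \<in> H" by (rule kernel_span_mem[OF q])
    let ?a = "\<lambda>z. Re (?e (r *\<^sub>R z))" and ?b = "\<lambda>z. Re (?e (s *\<^sub>R z))"
      and ?c = "\<lambda>z. Re (q (r *\<^sub>R z)) - Re (q (s *\<^sub>R z))"
    have ia: "set_integrable \<mu> B ?a" and ib: "set_integrable \<mu> B ?b" and ic: "set_integrable \<mu> B ?c"
      using r r0 s by (auto intro!: int continuous_intros dil h qH)
    have "?c z \<le> \<epsilon> / 3" if "z \<in> B" for z
    proof -
      have z: "norm z = 1" using that sub by auto
      have "dist (r *\<^sub>R z) (s *\<^sub>R z) = \<bar>r - s\<bar>"
        using z by (simp add: dist_norm flip: scaleR_diff_left)
      also have "\<dots> < \<delta>" using r s by (auto simp: R_def)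
      finally have "dist (p (r *\<^sub>R z)) (p (s *\<^sub>R z)) < \<epsilon> / 3"
        using r r0 s z by (intro \<delta>(2)) auto
      moreover have "q (r *\<^sub>R z) = p (r *\<^sub>R z)" "q (s *\<^sub>R z) = p (s *\<^sub>R z)"
        using r r0 s z by (auto intro!: p(2))
      ultimately show ?thesis
        using abs_Re_le_cmod[of "q (r *\<^sub>R z) - q (s *\<^sub>R z)"] by (simp add: dist_norm)
    qed
    then have "(LINT z:B|\<mu>. ?c z) \<le> (LINT z:B|\<mu>. \<epsilon> / 3)"
      by (intro set_integral_mono ic int) auto
    also have "\<dots> = \<epsilon> / 3 * measure \<mu> B" by (rule sphere_probs_set_integral_const[OF \<mu> B])
    also have "\<dots> \<le> \<epsilon> / 3 * ?E" using \<open>0 < \<epsilon>\<close> by (intro mult_left_mono order_trans[OF prob_le_1 E]) auto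
    finally have c: "(LINT z:B|\<mu>. ?c z) \<le> \<epsilon> / 3 * ?E" .
    have a: "\<bar>LINT z:B|\<mu>. ?a z\<bar> \<le> \<epsilon> / 3 * ?E"
      using r r0 E by (intro order_trans[OF dilation_integral_bound[OF da e \<mu> B _ _ fin] mult_right_mono[OF Ne]]) auto
    have b: "\<bar>LINT z:B|\<mu>. ?b z\<bar> \<le> \<epsilon> / 3 * ?E"
      using s r0 E by (intro order_trans[OF dilation_integral_bound[OF da e \<mu> B _ _ fin] mult_right_mono[OF Ne]]) auto
    have "(LINT z:B|\<mu>. Re (h (r *\<^sub>R z)) - Re (h (s *\<^sub>R z))) = (LINT z:B|\<mu>. (?a z - ?b z) + ?c z)"
      by (rule arg_cong[where f = "set_lebesgue_integral \<mu> B"]) auto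
    also have "\<dots> = (LINT z:B|\<mu>. ?a z) - (LINT z:B|\<mu>. ?b z) + (LINT z:B|\<mu>. ?c z)"
      using ia ib ic by (simp only: set_integral_add(2) set_integral_diff)
    finally show ?thesis using a b c by linarith
  qed
  then show ?thesis
    using \<delta>(1) by (intro exI[of _ R]) (simp add: R_def)
qed


section \<open>Capacity of sets where radial limits are far from zero\<close>

text \<open>One open superset bounds the infimum, and there it suffices to bound all finite energies
  from below.\<close>

lemma outer_cap_le:
  assumes "openin (top_of_set (sphere 0 1)) G" "E \<subseteq> G" "0 < \<eta>"
    and "\<And>F \<mu>. compact F \<Longrightarrow> F \<subseteq> G \<Longrightarrow> \<mu> \<in> sphere_probs F \<Longrightarrow> da_energy \<mu> < \<infinity> \<Longrightarrow> 1 \<le> \<eta> * enn2real (da_energy \<mu>)"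
  shows "da_outer_cap E \<le> ennreal \<eta>"
proof -
  have "1 / da_energy \<mu> \<le> ennreal \<eta>" if K: "compact F" and F: "F \<subseteq> G" and \<mu>: "\<mu> \<in> sphere_probs F" for F \<mu>
  proof (cases "da_energy \<mu> < \<infinity>")
    case True
    define e where "e = enn2real (da_energy \<mu>)"
    have E: "da_energy \<mu> = ennreal e" using True by (simp add: e_def less_top)
    have e: "1 \<le> \<eta> * e" using assms(4)[OF K F \<mu> True] by (simp add: e_def)
    then have "e > 0" using \<open>0 < \<eta>\<close> by (smt (verit) mult_nonneg_nonpos)
    then have "1 / da_energy \<mu> = ennreal (1 / e)"
      using divide_ennreal[of 1 e] by (simp add: E)
    also have "\<dots> \<le> ennreal \<eta>"
      using e \<open>e > 0\<close> by (intro ennreal_leI) (simp add: field_simps)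
    finally show ?thesis .
  next
    \<comment> \<open>Infinite energy contributes \<open>1 / \<infinity> = 0\<close> to the
      supremum.\<close>
    case False
    then have "da_energy \<mu> = \<infinity>" by (simp add: not_less top_unique)
    then show ?thesis by (simp add: divide_ennreal_def)
  qed
  then have "da_inner_cap G \<le> ennreal \<eta>"
    unfolding da_inner_cap_def da_cap_compact_def by (intro SUP_least) auto
  moreover have "da_outer_cap E \<le> da_inner_cap G"
    unfolding da_outer_cap_def using assms(1,2) by (intro INF_lower) auto
  ultimately show ?thesis by (rule order_trans[rotated])
qed

text \<open>The constant 16 is the square of 4: the starting condition and the increment conditions
  each account for mass at most \<open>2 * \<delta> * e\<close>, where \<open>e\<close> is the
  square root of the energy.\<close>

lemma radial_limit_minus_one_outer_cap:
  fixes g :: "complex ^ 'n \<Rightarrow> complex"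
  assumes da: "drury_arveson H ip" and g: "g \<in> H" and \<delta>: "0 < \<delta>" "sqrt (Re (ip g g)) \<le> \<delta>"
    and E: "E \<subseteq> sphere 0 1"
    and lim: "\<And>\<zeta>. \<zeta> \<in> E \<Longrightarrow> ((\<lambda>r. Re (g (r *\<^sub>R \<zeta>))) \<longlongrightarrow> -1) (at_left 1)"
  shows "da_outer_cap E \<le> ennreal (16 * \<delta>\<^sup>2)"
proof -
  \<comment> \<open>The thresholds \<open>t j / 8\<close> sum to 1/4, the gap between -1/2 and -3/4,
    while the mass bounds \<open>\<delta> * e * t j\<close> sum to
    \<open>2 * \<delta> * e\<close>.\<close>
  define t :: "nat \<Rightarrow> real" where "t j = (1/2) ^ j" for j
  have t: "0 < t j" for j by (simp add: t_def)
  \<comment> \<open>The tolerance is the threshold \<open>t j / 8\<close> times the mass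
    \<open>\<delta> * t j\<close> that a Chebyshev estimate is to yield.\<close>
  define small_increments where "small_increments j R \<longleftrightarrow> (\<forall>r s F \<mu> B. R \<le> r \<longrightarrow> r < 1 \<longrightarrow> R \<le> s \<longrightarrow> s < 1 \<longrightarrow>
      \<mu> \<in> sphere_probs F \<longrightarrow> B \<in> sets \<mu> \<longrightarrow> da_energy \<mu> < \<infinity> \<longrightarrow>
      (LINT z:B|\<mu>. Re (g (r *\<^sub>R z)) - Re (g (s *\<^sub>R z)))
        \<le> (t j / 8 * (\<delta> * t j)) * sqrt (enn2real (da_energy \<mu>)))" for j R
  have "\<exists>R\<ge>0. R < 1 \<and> small_increments j R" for j
    unfolding small_increments_def
    using \<delta> t by (intro dilation_increment_bound[OF da g]) simp
  then obtain R where R: "\<And>j. 0 \<le> R j" "\<And>j. R j < 1" and "\<And>j. small_increments j (R j)"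
    by metis
  then have incr: "(LINT z:B|\<mu>. Re (g (r *\<^sub>R z)) - Re (g (s *\<^sub>R z)))
        \<le> (t j / 8 * (\<delta> * t j)) * sqrt (enn2real (da_energy \<mu>))"
    if "R j \<le> r" "r < 1" "R j \<le> s" "s < 1" "\<mu> \<in> sphere_probs F" "B \<in> sets \<mu>" "da_energy \<mu> < \<infinity>"
    for j r s F \<mu> B
    using that unfolding small_increments_def by blast
  \<comment> \<open>The maximum over all \<open>i \<le> j\<close> puts both \<open>r j\<close> and
    \<open>r (Suc j)\<close> above \<open>R j\<close>; the entry \<open>1 - t j\<close> forces
    convergence to 1.\<close>
  define r where "r j = Max (R ` {..j} \<union> {1 - t j})" for j
  have r_ge: "R i \<le> r j" if "i \<le> j" for i j
    unfolding r_def using that by (intro Max_ge) auto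
  have r1: "r j < 1" for j
    unfolding r_def using R(2) t[of j] by (subst Max_less_iff) auto
  have r0: "0 \<le> r j" for j using R(1)[of j] r_ge[of j j] by simp
  have "r \<longlonglongrightarrow> 1"
  proof (rule tendsto_sandwich)
    show "\<forall>\<^sub>F j in sequentially. 1 - t j \<le> r j"
      by (intro always_eventually allI) (auto simp: r_def)
    show "\<forall>\<^sub>F j in sequentially. r j \<le> 1"
      using r1 by (intro always_eventually allI less_imp_le)
    have "t \<longlonglongrightarrow> 0" unfolding t_def by (rule LIMSEQ_realpow_zero) auto
    then show "(\<lambda>j. 1 - t j) \<longlonglongrightarrow> 1" using tendsto_diff[OF tendsto_const[of 1], of t 0] by simp
  qed simp
  then have r_lim: "filterlim r (at_left 1) sequentially"
    unfolding filterlim_at using r1 by (auto intro!: always_eventually simp: less_imp_neq)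
  \<comment> \<open>Strict inequalities between continuous functions make \<open>A\<close> and every
    \<open>V j\<close> relatively open.\<close>
  define A where "A = sphere 0 1 \<inter> (\<lambda>z. Re (g (r 0 *\<^sub>R z))) -` {..<- 1/2}"
  define V where "V j = sphere 0 1 \<inter> (\<lambda>z. Re (g (r j *\<^sub>R z)) - Re (g (r (Suc j) *\<^sub>R z))) -` {t j / 8<..}" for j
  define G where "G = A \<union> (\<Union>j. V j)"
  note dil = drury_arveson_dilation_continuous_on[OF da g r0 r1]
  have openA: "openin (top_of_set (sphere 0 1)) A"
    unfolding A_def by (intro continuous_openin_preimage_gen continuous_intros dil open_lessThan open_greaterThan)
  have openV: "openin (top_of_set (sphere 0 1)) (V j)" for j
    unfolding V_def by (intro continuous_openin_preimage_gen continuous_intros dil open_lessThan open_greaterThan)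
  have openG: "openin (top_of_set (sphere 0 1)) G"
    unfolding G_def using openV by (intro openin_Un openA openin_Union) blast
  have "E \<subseteq> G"
  proof
    fix \<zeta> assume \<zeta>: "\<zeta> \<in> E"
    then have sph: "\<zeta> \<in> sphere 0 1" using E by auto
    let ?u = "\<lambda>j. Re (g (r j *\<^sub>R \<zeta>))"
    show "\<zeta> \<in> G"
    proof (rule ccontr)
      assume "\<zeta> \<notin> G"
      then have u0: "- 1/2 \<le> ?u 0" and uS: "\<And>j. ?u j - ?u (Suc j) \<le> t j / 8"
        using sph by (auto simp: G_def A_def V_def not_less)
      \<comment> \<open>Starting from -1/2, the first \<open>j\<close> decrements total at most
        \<open>(1 - t j) / 4\<close>, which gives this closed form. It stays above -3/4,
        contradicting the limit -1.\<close>
      have lower: "t j / 4 - 3/4 \<le> ?u j" for j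
      proof (induction j)
        case 0 then show ?case using u0 by (simp add: t_def)
      next
        case (Suc j) then show ?case using uS[of j] by (simp add: t_def field_simps)
      qed
      have bound: "- 3/4 \<le> ?u j" for j
        by (rule order_trans[OF _ lower]) (use t[of j] in simp)
      have "?u \<longlonglongrightarrow> -1"
        by (rule filterlim_compose[OF lim[OF \<zeta>] r_lim])
      then have "- 3/4 \<le> (-1::real)"
        by (rule LIMSEQ_le_const) (intro exI allI impI bound)
      then show False by simp
    qed
  qed
  moreover have "1 \<le> 16 * \<delta>\<^sup>2 * enn2real (da_energy \<mu>)"
    if K: "compact F" and F: "F \<subseteq> G" and \<mu>: "\<mu> \<in> sphere_probs F" and fin: "da_energy \<mu> < \<infinity>" for F \<mu>
  proof -
    interpret prob_space \<mu> using \<mu> by (rule sphere_probsD)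
    define e where "e = sqrt (enn2real (da_energy \<mu>))"
    have e0: "0 \<le> e" by (simp add: e_def)
    have A: "A \<in> sets \<mu>" and V: "\<And>j. V j \<in> sets \<mu>" and Gs: "G \<in> sets \<mu>"
      by (intro sphere_openin_sets[OF \<mu>] openA openV openG)+
    note int = sphere_probs_set_integrable[OF \<mu>]
    \<comment> \<open>Chebyshev's inequality on \<open>A\<close>, where the negated real part
      exceeds 1/2.\<close>
    have mA: "measure \<mu> A / 2 \<le> \<delta> * e"
    proof -
      have "1/2 * measure \<mu> A = (LINT z:A|\<mu>. 1/2)"
        by (rule sphere_probs_set_integral_const[OF \<mu> A, symmetric])
      also have "\<dots> \<le> (LINT z:A|\<mu>. - Re (g (r 0 *\<^sub>R z)))"
        by (intro set_integral_mono int continuous_intros dil A) (auto simp: A_def)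
      also have "\<dots> = - (LINT z:A|\<mu>. Re (g (r 0 *\<^sub>R z)))"
        by (intro set_integral_uminus int continuous_intros dil A)
      also have "\<dots> \<le> sqrt (Re (ip g g)) * e"
        using dilation_integral_bound[OF da g \<mu> A r0 r1 fin, of 0] by (simp add: e_def)
      also have "\<dots> \<le> \<delta> * e" using \<delta>(2) e0 by (rule mult_right_mono)
      finally show ?thesis by simp
    qed
    \<comment> \<open>Chebyshev's inequality on \<open>V j\<close>: the threshold
      \<open>t j / 8\<close> cancels against the same factor in the increment bound.\<close>
    have mV: "measure \<mu> (V j) \<le> \<delta> * e * t j" for j
    proof -
      have "t j / 8 * measure \<mu> (V j) = (LINT z:V j|\<mu>. t j / 8)"
        by (rule sphere_probs_set_integral_const[OF \<mu> V, symmetric])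
      also have "\<dots> \<le> (LINT z:V j|\<mu>. Re (g (r j *\<^sub>R z)) - Re (g (r (Suc j) *\<^sub>R z)))"
        by (intro set_integral_mono int continuous_intros dil V) (auto simp: V_def)
      also have "\<dots> \<le> (t j / 8 * (\<delta> * t j)) * e"
        unfolding e_def by (intro incr[OF _ r1 _ r1 \<mu> V fin] r_ge le_refl le_SucI)
      also have "\<dots> = t j / 8 * (\<delta> * e * t j)" by simp
      finally show ?thesis by (rule mult_left_le_imp_le) (use t[of j] in simp)
    qed
    have tsums: "(\<lambda>j. \<delta> * e * t j) sums (\<delta> * e * 2)"
      unfolding t_def using sums_mult[OF geometric_sums[of "1/2::real"], of "\<delta> * e"] by simp
    have summ: "summable (\<lambda>j. measure \<mu> (V j))"
      using mV by (intro summable_comparison_test'[OF sums_summable[OF tsums]]) auto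
    have "measure \<mu> (\<Union>j. V j) \<le> (\<Sum>j. measure \<mu> (V j))"
      using V by (intro finite_measure_subadditive_countably summ) auto
    also have "\<dots> \<le> (\<Sum>j. \<delta> * e * t j)"
      by (intro suminf_le mV summ sums_summable[OF tsums])
    also have "\<dots> = \<delta> * e * 2" using tsums by (simp add: sums_iff)
    finally have mUV: "measure \<mu> (\<Union>j. V j) \<le> \<delta> * e * 2" .
    have mG: "measure \<mu> G \<le> measure \<mu> A + measure \<mu> (\<Union>j. V j)"
      unfolding G_def using A sets.countable_UN[of V UNIV \<mu>] V by (intro measure_Un_le) blast+
    \<comment> \<open>The complement of \<open>G\<close> lies in the complement of \<open>F\<close>,
      which is a null set for \<open>\<mu>\<close>.\<close>
    have "measure \<mu> G = 1"
    proof -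
      have "emeasure \<mu> (space \<mu> - G) \<le> emeasure \<mu> (sphere 0 1 - F)"
      proof (rule emeasure_mono)
        have "openin (top_of_set (sphere 0 1)) (sphere 0 1 - F)"
          using compact_imp_closed[OF K] by (simp add: openin_open_Int Diff_eq open_Compl)
        then show "sphere 0 1 - F \<in> sets \<mu>" by (rule sphere_openin_sets[OF \<mu>])
      qed (use F sphere_probsD(3)[OF \<mu>] in auto)
      then have "measure \<mu> (space \<mu> - G) = 0"
        using sphere_probsD(4)[OF \<mu>] by (simp add: measure_def)
      then show ?thesis using prob_compl[OF Gs] by simp
    qed
    then have "1 \<le> 4 * \<delta> * e" using mA mUV mG by linarith
    \<comment> \<open>Squaring turns the square root \<open>e\<close> back into the energy.\<close>
    then have "1 ^ 2 \<le> (4 * \<delta> * e)\<^sup>2" by (rule power_mono) simp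
    then show ?thesis by (simp add: e_def power_mult_distrib)
  qed
  ultimately show ?thesis using \<delta>(1) by (intro outer_cap_le[OF openG]) simp_all
qed

section \<open>From cyclicity to zero outer capacity\<close>

lemma polynomial_vec_continuous_on: "polynomial_vec p \<Longrightarrow> continuous_on S p"
  unfolding polynomial_vec_def by (auto intro!: continuous_intros)

theorem theorem1p5:
  fixes H :: "(complex ^ 'n \<Rightarrow> complex) set"
    and ip :: "(complex ^ 'n \<Rightarrow> complex) \<Rightarrow> (complex ^ 'n \<Rightarrow> complex) \<Rightarrow> complex"
    and f :: "complex ^ 'n \<Rightarrow> complex"
  assumes "drury_arveson H ip"
    and "f \<in> H"
    and "da_cyclic H ip f"
  shows "da_outer_cap (radial_zero_set f) = 0"
proof -
  have "da_outer_cap (radial_zero_set f) \<le> ennreal (16 * \<delta>\<^sup>2)" if "0 < \<delta>" for \<delta>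
  proof -
    interpret rkhs "ball 0 1" da_kernel H ip using assms(1) by (simp add: drury_arveson_def)
    obtain p where p: "\<And>k::nat. polynomial_vec (p k)" "\<And>k. (\<lambda>z. p k z * f z) \<in> H"
      and "(\<lambda>k. ip_dist ip (\<lambda>z. p k z * f z) (indicator (ball 0 1))) \<longlonglongrightarrow> 0"
      using assms(3) by (auto simp: da_cyclic_def)
    from order_tendstoD(2)[OF this(3) that] obtain k
      where k: "ip_dist ip (\<lambda>z. p k z * f z) (indicator (ball 0 1)) < \<delta>"
      by (auto simp: eventually_sequentially)
    let ?g = "\<lambda>z. p k z * f z - indicator (ball 0 1) z"
    \<comment> \<open>The kernel function at the origin is the constant 1 on the ball, so the
      constant belongs to \<open>H\<close>.\<close>
    have "ker 0 = indicator (ball 0 1)"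
      by (auto simp: ker_def da_kernel_def hermitian_inner_def indicator_def)
    then have "indicator (ball 0 1) \<in> H" using ker_mem[of 0] by simp
    then have g: "?g \<in> H" using p(2) by (intro diff_mem)
    show ?thesis
    proof (rule radial_limit_minus_one_outer_cap[OF assms(1) g that])
      show "sqrt (Re (ip ?g ?g)) \<le> \<delta>" using k by (simp add: ip_dist_def ip_norm_def)
      show "radial_zero_set f \<subseteq> sphere 0 1" by (auto simp: radial_zero_set_def)
      fix \<zeta> assume "\<zeta> \<in> radial_zero_set f"
      then have \<zeta>: "norm \<zeta> = 1" and lim: "((\<lambda>r. f (r *\<^sub>R \<zeta>)) \<longlongrightarrow> 0) (at_left 1)"
        by (auto simp: radial_zero_set_def)
      \<comment> \<open>The polynomial is continuous at the boundary point, so its finite limit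
        times the zero limit of \<open>f\<close> is zero.\<close>
      have "isCont (p k) (1 *\<^sub>R \<zeta>)"
        using polynomial_vec_continuous_on[OF p(1), of UNIV k] by (simp add: continuous_on_eq_continuous_at)
      then have "((\<lambda>r. p k (r *\<^sub>R \<zeta>)) \<longlongrightarrow> p k (1 *\<^sub>R \<zeta>)) (at_left 1)"
        by (rule isCont_tendsto_compose) (intro tendsto_intros)
      from tendsto_diff[OF tendsto_mult[OF this lim] tendsto_const[of 1]]
      have "((\<lambda>r. Re (p k (r *\<^sub>R \<zeta>) * f (r *\<^sub>R \<zeta>) - 1)) \<longlongrightarrow> -1) (at_left 1)"
        using tendsto_Re by fastforce
      \<comment> \<open>For radii in \<open>(0, 1)\<close> the point lies in the open ball, where
        the indicator equals 1.\<close>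
      moreover have "\<forall>\<^sub>F r in at_left 1. Re (p k (r *\<^sub>R \<zeta>) * f (r *\<^sub>R \<zeta>) - 1) = Re (?g (r *\<^sub>R \<zeta>))"
        using eventually_at_left_real[of 0 "1::real"] \<zeta> by (auto elim!: eventually_mono)
      ultimately show "((\<lambda>r. Re (?g (r *\<^sub>R \<zeta>))) \<longlongrightarrow> -1) (at_left 1)"
        by (rule Lim_transform_eventually)
    qed
  qed
  note bound = this
  have "da_outer_cap (radial_zero_set f) \<le> ennreal \<eta>" if "0 < \<eta>" for \<eta>
  proof -
    \<comment> \<open>The choice of \<delta> as the root of \<eta>/16 makes the bound exactly
      \<eta>.\<close>
    have "16 * (sqrt (\<eta> / 16))\<^sup>2 = \<eta>" using that by simp
    with bound[of "sqrt (\<eta> / 16)"] that show ?thesis by simp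
  qed
  then have "da_outer_cap (radial_zero_set f) \<le> 0"
    by (subst ennreal_le_epsilon) simp_all
  then show ?thesis by simp
qed

end
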